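(* Let $n\geq2$, let $K\subset\mathbb{R}^n$ be an $n$-dimensional convex polyhedron and let $p\in K$. Assume that $p$ is the origin and that the point $e_1:=(1,0,\ldots,0)$ belongs to $\operatorname{Int}(K)$. Consider the polynomial map $\alpha:\mathbb{R}\to\mathbb{R}^n,\ t\mapsto(t^2,t^3,0,\ldots,0)$. Then there exists $\varepsilon>0$ such that $\alpha([-\varepsilon,\varepsilon])\subset\operatorname{Int}(K)\cup\{p\}$.
   Context: A convex polyhedron in $\mathbb{R}^n$ is a finite intersection of closed half-spaces (possibly unbounded). $\operatorname{Int}$ denotes the interior in $\mathbb{R}^n$. *)

theory Defs
  imports "HOL-Analysis.Analysis"
begin

text \<open>
  The index type of \<open>real ^ 'n\<close> carries no order, so the first and the second coordinate are
  given by two distinct indices \<open>i1\<close> and \<open>i2\<close>; the point $e_1$ is then \<open>axis i1 1\<close>.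
\<close>

definition cusp_curve :: "'n::finite \<Rightarrow> 'n \<Rightarrow> real \<Rightarrow> real ^ 'n" where
  "cusp_curve i1 i2 t = (\<chi> k. if k = i1 then t ^ 2 else if k = i2 then t ^ 3 else 0)"

end

theory Submission imports Defs begin

text \<open>
  Write \<open>e\<^sub>1\<close>, \<open>e\<^sub>2\<close> for the axis vectors of \<open>i1\<close>, \<open>i2\<close>. The cusp factors as
  \<open>\<alpha>(t) = t\<^sup>2 (e\<^sub>1 + t e\<^sub>2)\<close>. For small \<open>t\<close> the second factor stays near \<open>e\<^sub>1\<close>, hence in the
  interior of \<open>K\<close>. For \<open>0 < \<bar>t\<bar> \<le> 1\<close> the point \<open>\<alpha>(t)\<close> therefore lies on the segment from
  the origin, a point of \<open>K\<close>, to an interior point of \<open>K\<close>, and it is not the origin; in a convex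
  set such a point is interior (lemma \<open>mem_interior_convex_shrink\<close>). At \<open>t = 0\<close> the curve
  passes through the origin.
\<close>

lemma cusp_curve_eq_scaleR:
  assumes "i1 \<noteq> i2"
  shows "cusp_curve i1 i2 t = t\<^sup>2 *\<^sub>R (axis i1 1 + t *\<^sub>R axis i2 1)"
  using assms
  by (auto simp: cusp_curve_def vec_eq_iff axis_def power2_eq_square power3_eq_cube)

theorem lemma4p1:
  fixes K :: "(real ^ 'n::finite) set" and p :: "real ^ 'n" and i1 i2 :: 'n
  assumes "CARD('n) \<ge> 2"
    and "i1 \<noteq> i2"
    and "polyhedron K"
    and "aff_dim K = int CARD('n)"
    and "p \<in> K"
    and "p = 0"
    and "axis i1 1 \<in> interior K"
  shows "\<exists>\<epsilon>>0. cusp_curve i1 i2 ` {-\<epsilon>..\<epsilon>} \<subseteq> interior K \<union> {p}"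
proof -
  have "convex K"
    using \<open>polyhedron K\<close> by (rule polyhedron_imp_convex)
  obtain r where "r > 0" and r: "cball (axis i1 1) r \<subseteq> interior K"
    using \<open>axis i1 1 \<in> interior K\<close> open_contains_cball open_interior by blast
  \<comment> \<open>The bound by 1 makes \<open>t\<^sup>2\<close> a convex coefficient.\<close>
  define \<epsilon> where "\<epsilon> = min 1 r"
  have "cusp_curve i1 i2 t \<in> interior K \<union> {p}" if t: "t \<in> {-\<epsilon>..\<epsilon>}" for t
  proof (cases "t = 0")
    case True
    then show ?thesis
      using \<open>p = 0\<close> by (simp add: cusp_curve_eq_scaleR[OF \<open>i1 \<noteq> i2\<close>])
  next
    case False
    have "\<bar>t\<bar> \<le> 1" "\<bar>t\<bar> \<le> r"
      using t by (auto simp: \<epsilon>_def)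
    define x where "x = axis i1 1 + t *\<^sub>R (axis i2 1 :: real ^ 'n)"
    have "dist (axis i1 1) x = \<bar>t\<bar>"
      by (simp add: x_def dist_norm)
    then have "x \<in> interior K"
      using r \<open>\<bar>t\<bar> \<le> r\<close> by auto
    moreover have "0 < t\<^sup>2" "t\<^sup>2 \<le> 1"
      using False \<open>\<bar>t\<bar> \<le> 1\<close> by (auto simp: abs_square_le_1)
    ultimately have "p - t\<^sup>2 *\<^sub>R (p - x) \<in> interior K"
      using \<open>convex K\<close> \<open>p \<in> K\<close> by (intro mem_interior_convex_shrink)
    moreover have "p - t\<^sup>2 *\<^sub>R (p - x) = cusp_curve i1 i2 t"
      using \<open>p = 0\<close> by (simp add: x_def cusp_curve_eq_scaleR[OF \<open>i1 \<noteq> i2\<close>] algebra_simps)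
    ultimately show ?thesis
      by simp
  qed
  moreover have "\<epsilon> > 0"
    using \<open>r > 0\<close> by (simp add: \<epsilon>_def)
  ultimately show ?thesis
    by blast
qed

end
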